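(* Let $T$ be a tree with $\kappa_{\mathrm m}(T)=2$, and write $M_T=fg$ with $f,g\in\mathbb Z[x]$ distinct, monic and irreducible over $\mathbb Q$. Write $\Gamma_T(x)=\dfrac{P(x)}{f(x)g(x)}$ with $P\in\mathbb Q[x]$, $\deg P<\deg f+\deg g$, $\gcd(P,fg)=1$. Then there exist unique polynomials $A,B\in\mathbb Q[x]$ such that $P=Ag+Bf$, $\deg A<\deg f$, $\deg B<\deg g$. Define $$\Gamma_f(x):=\frac{A(x)}{f(x)},\qquad \Gamma_g(x):=\frac{B(x)}{g(x)}.$$ Then $\Gamma_T=\Gamma_f+\Gamma_g$, and both fractions are reduced. If $H=R\cup U$ is a disconnected graph generalized cospectral with $T$, with connected components $R$ and $U$ satisfying $M_R=f$ and $M_U=g$, then $\Gamma_R=\Gamma_f$ and $\Gamma_U=\Gamma_g$.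
   Context: All graphs are finite, simple and undirected. For a graph $G$, $A(G)$ is its adjacency matrix, $\phi_G(x)=\det(xI-A(G))$, $\mathbf 1$ is the all-one vector, and the coronal is the rational function $\Gamma_G(x)=\mathbf 1^{T}(xI-A(G))^{-1}\mathbf 1$. Two graphs are generalized cospectral if they have the same adjacency spectrum and their complements have the same adjacency spectrum. An adjacency eigenvalue is main if its eigenspace is not orthogonal to $\mathbf 1$; the main polynomial $M_G(x)$ is the product of $(x-\lambda)$ over the distinct main eigenvalues $\lambda$ of $G$; it divides $\phi_G$ in $\mathbb Z[x]$ and is the monic denominator of $\Gamma_G$ in lowest terms. If $\phi_G=\prod_{i=1}^r f_i^{m_i}$ with $f_i$ distinct, monic and irreducible over $\mathbb Q$, the main-factor multiplicity is $\kappa_{\mathrm m}(G):=\sum_{i:\,f_i\mid M_G} m_i$. When $T$ is a tree with $\kappa_{\mathrm m}(T)=2$, $M_T$ is a product of exactly two distinct monic irreducible polynomials $f,g$. *)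

theory Defs
  imports
    "Graph_Theory.Graph_Theory"
    "Jordan_Normal_Form.Char_Poly"
    "Jordan_Normal_Form.Gauss_Jordan_Elimination"
    "HOL-Computational_Algebra.Polynomial_Factorial"
    "HOL-Computational_Algebra.Field_as_Ring"
begin

text \<open>
  A finite simple undirected graph is a digraph satisfying \<^locale>\<open>pair_graph\<close>: each edge is
  represented by its two opposite arcs.

  The library's \<open>tree\<close> forbids every directed cycle, in particular \<open>u, v, u\<close>, so in this
  representation it admits no graph with an edge.  The cycles of an undirected graph are the
  directed ones of length at least 3.
\<close>

definition undirected_tree :: "'a pair_pre_digraph \<Rightarrow> bool" where
  "undirected_tree G \<longleftrightarrow>
     pair_graph G \<and> connected G \<and> \<not> (\<exists>p. pre_digraph.cycle G p \<and> length p \<ge> 3)"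

definition complement :: "'a pair_pre_digraph \<Rightarrow> 'a pair_pre_digraph" where
  "complement G =
     \<lparr>pverts = pverts G,
      parcs = {(u, v). u \<in> pverts G \<and> v \<in> pverts G \<and> u \<noteq> v \<and> (u, v) \<notin> parcs G}\<rparr>"

text \<open>
  The adjacency matrix is taken with respect to an arbitrary enumeration of the vertices; everything
  derived from it below is invariant under simultaneous permutation of rows and columns.
\<close>

definition vertex_list :: "'a pair_pre_digraph \<Rightarrow> 'a list" where
  "vertex_list G = (SOME vs. distinct vs \<and> set vs = pverts G)"

definition adjacency_matrix :: "'a pair_pre_digraph \<Rightarrow> 'b :: zero_neq_one mat" where
  "adjacency_matrix G =
     mat (card (pverts G)) (card (pverts G))
       (\<lambda>(i, j). if (vertex_list G ! i, vertex_list G ! j) \<in> parcs G then 1 else 0)"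

definition all_ones :: "'a pair_pre_digraph \<Rightarrow> 'b :: one vec" where
  "all_ones G = vec (card (pverts G)) (\<lambda>_. 1)"

text \<open>
  Spectrum and main eigenvalues are computed over \<open>\<complex>\<close>; as the matrix is real symmetric, the
  eigenvalues are real.  The spectrum is a multiset (algebraic multiplicities).
\<close>

definition adjacency_spectrum :: "'a pair_pre_digraph \<Rightarrow> complex multiset" where
  "adjacency_spectrum G = proots (char_poly (adjacency_matrix G))"

definition generalized_cospectral ::
  "'a pair_pre_digraph \<Rightarrow> 'b pair_pre_digraph \<Rightarrow> bool" where
  "generalized_cospectral G H \<longleftrightarrow>
     adjacency_spectrum G = adjacency_spectrum H \<and>
     adjacency_spectrum (complement G) = adjacency_spectrum (complement H)"

definition main_eigenvalue :: "'a pair_pre_digraph \<Rightarrow> complex \<Rightarrow> bool" where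
  "main_eigenvalue G l \<longleftrightarrow>
     (\<exists>v. eigenvector (adjacency_matrix G) v l \<and> all_ones G \<bullet> v \<noteq> 0)"

definition main_poly :: "'a pair_pre_digraph \<Rightarrow> complex poly" where
  "main_poly G = (\<Prod>l | main_eigenvalue G l. [:- l, 1:])"

definition main_factor_multiplicity :: "'a pair_pre_digraph \<Rightarrow> nat" where
  "main_factor_multiplicity G =
     (let \<phi> = char_poly (adjacency_matrix G) :: rat poly
      in \<Sum>p | irreducible p \<and> lead_coeff p = 1 \<and> p dvd \<phi> \<and> map_poly of_rat p dvd main_poly G.
           multiplicity p \<phi>)"

text \<open>
  The coronal is an element of \<open>\<rat>(x)\<close>, the fraction field of \<open>\<rat>[x]\<close>;
  \<^const>\<open>char_poly_matrix\<close> is \<open>xI - A\<close>.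
\<close>

definition coronal :: "'a pair_pre_digraph \<Rightarrow> rat poly fract" where
  "coronal G =
     all_ones G \<bullet>
       (the (mat_inverse (map_mat to_fract (char_poly_matrix (adjacency_matrix G)))) *\<^sub>v all_ones G)"

end

theory Submission
  imports Defs
begin

text \<open>
  The coronal is the sum over the vertices of any solution of \<open>(xI - A) y = \<one>\<close>; since \<open>A\<close> is
  symmetric, this sum does not depend on the solution.  Restricting a solution to the components
  of \<open>H\<close> gives \<open>\<Gamma>\<^sub>H = \<Gamma>\<^sub>R + \<Gamma>\<^sub>U\<close>, and the matrix determinant lemma shows that
  \<open>\<phi>\<close> and the characteristic polynomial of the complement determine the coronal, so
  \<open>\<Gamma>\<^sub>H = \<Gamma>\<^sub>T\<close>.

  The main polynomial is a denominator of the coronal: take \<open>(xI - A) N(x) = p(x) \<one>\<close> with complex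
  polynomials and \<open>p\<close> of least degree.  If \<open>p = (x - l) h\<close>, then \<open>w = N(l)\<close> is a nonzero
  eigenvector, and pairing the equation with the conjugate of \<open>w\<close> gives
  \<open>\<parallel>w\<parallel>\<^sup>2 = h(l) \<cdot> cnj (\<one> \<bullet> w)\<close>.  Hence \<open>l\<close> is main and a simple root, so \<open>p\<close> divides \<open>M\<close>.
  Thus \<open>\<Gamma>\<^sub>R\<close> and \<open>\<Gamma>\<^sub>U\<close> are proper fractions over \<open>f\<close> and \<open>g\<close>, and the
  partial fraction decomposition is unique.
\<close>

section \<open>The coronal through the resolvent equation\<close>

text \<open>Encodes (xI - A) N = p 1 with functions on vertices instead of vectors, so that passing
  to a component needs no reindexing. The free right-hand side \<open>p\<close> lets denominators be
  cleared, and \<open>p = 0\<close> gives the eigenvector equation.\<close>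

definition resolvent_eq :: "'a pair_pre_digraph \<Rightarrow> 'k \<Rightarrow> 'k \<Rightarrow> ('a \<Rightarrow> 'k::comm_ring_1) \<Rightarrow> bool" where
  "resolvent_eq G x p N \<longleftrightarrow>
     (\<forall>u\<in>pverts G. x * N u = p + (\<Sum>w\<in>pverts G. if (u, w) \<in> parcs G then N w else 0))"

lemma resolvent_eqD:
  "resolvent_eq G x p N \<Longrightarrow> u \<in> pverts G \<Longrightarrow>
     x * N u = p + (\<Sum>w\<in>pverts G. if (u, w) \<in> parcs G then N w else 0)"
  by (simp add: resolvent_eq_def)

lemma adjacency_sum_swap:
  fixes N L :: "'a \<Rightarrow> 'k::comm_ring_1"
  assumes "sym (parcs G)"
  shows "(\<Sum>u\<in>pverts G. L u * (\<Sum>w\<in>pverts G. if (u, w) \<in> parcs G then N w else 0)) =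
         (\<Sum>u\<in>pverts G. N u * (\<Sum>w\<in>pverts G. if (u, w) \<in> parcs G then L w else 0))"
proof -
  have sym: "(u, w) \<in> parcs G \<longleftrightarrow> (w, u) \<in> parcs G" for u w
    using assms by (auto dest: symD)
  have "(\<Sum>u\<in>pverts G. L u * (\<Sum>w\<in>pverts G. if (u, w) \<in> parcs G then N w else 0)) =
        (\<Sum>u\<in>pverts G. \<Sum>w\<in>pverts G. if (u, w) \<in> parcs G then L u * N w else 0)"
    by (auto simp: sum_distrib_left intro!: sum.cong)
  also have "\<dots> = (\<Sum>w\<in>pverts G. \<Sum>u\<in>pverts G. if (u, w) \<in> parcs G then L u * N w else 0)"
    by (rule sum.swap)
  also have "\<dots> = (\<Sum>u\<in>pverts G. N u * (\<Sum>w\<in>pverts G. if (u, w) \<in> parcs G then L w else 0))"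
    by (auto simp: sum_distrib_left sym intro!: sum.cong)
  finally show ?thesis .
qed

text \<open>Pair each equation with the other solution and subtract: symmetry of A cancels the
  adjacency terms. Of the two parameters, \<open>x = z\<close> compares totals of solutions, a
  conjugate pair shows that eigenvalues are real, and the variable against a constant isolates a
  linear factor.\<close>

lemma resolvent_eq_bilinear:
  assumes "sym (parcs G)" "resolvent_eq G x p N" "resolvent_eq G z q L"
  shows "(x - z) * (\<Sum>u\<in>pverts G. L u * N u) = p * sum L (pverts G) - q * sum N (pverts G)"
proof -
  let ?a = "\<lambda>N u. \<Sum>w\<in>pverts G. if (u, w) \<in> parcs G then N w else 0"
  have "(x - z) * (\<Sum>u\<in>pverts G. L u * N u) =
      (\<Sum>u\<in>pverts G. L u * (x * N u) - N u * (z * L u))"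
    by (auto simp: sum_distrib_left algebra_simps intro!: sum.cong)
  also have "\<dots> = (\<Sum>u\<in>pverts G. (p * L u - q * N u) + (L u * ?a N u - N u * ?a L u))"
    by (rule sum.cong)
       (simp_all add: resolvent_eqD[OF assms(2)] resolvent_eqD[OF assms(3)] algebra_simps)
  also have "\<dots> = p * sum L (pverts G) - q * sum N (pverts G)"
    using adjacency_sum_swap[OF assms(1), of L N]
    by (simp add: sum.distrib sum_subtractf sum_distrib_left)
  finally show ?thesis .
qed

lemma resolvent_eq_sum:
  assumes "sym (parcs G)" "resolvent_eq G x p N" "resolvent_eq G x q L"
  shows "p * sum L (pverts G) = q * sum N (pverts G)"
  using resolvent_eq_bilinear[OF assms] by simp

lemma resolvent_eq_mult:
  "resolvent_eq G x p N \<Longrightarrow> resolvent_eq G x (c * p) (\<lambda>u. c * N u)"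
  by (auto simp: resolvent_eq_def sum_distrib_left distrib_left mult.left_commute[of x]
      intro!: sum.cong)

text \<open>Serves for evaluation at a point, conjugation, inclusion of constants, and extension of
  coefficients from rational to complex.\<close>

lemma (in comm_ring_hom) resolvent_eq_hom:
  assumes "resolvent_eq G x p N"
  shows "resolvent_eq G (hom x) (hom p) (\<lambda>u. hom (N u))"
  unfolding resolvent_eq_def
proof
  fix u assume "u \<in> pverts G"
  then have "hom (x * N u) = hom (p + (\<Sum>w\<in>pverts G. if (u, w) \<in> parcs G then N w else 0))"
    using assms by (simp only: resolvent_eqD)
  then show "hom x * hom (N u) =
      hom p + (\<Sum>w\<in>pverts G. if (u, w) \<in> parcs G then hom (N w) else 0)"
    by (simp add: hom_mult hom_add hom_sum if_distrib[of hom] cong: if_cong)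
qed

section \<open>From matrices over an enumeration to functions on vertices\<close>

lemma vertex_list:
  assumes "finite (pverts G)"
  shows "distinct (vertex_list G)" "set (vertex_list G) = pverts G"
    "length (vertex_list G) = card (pverts G)"
proof -
  have "distinct (vertex_list G) \<and> set (vertex_list G) = pverts G"
    unfolding vertex_list_def
    using finite_distinct_list[OF assms] someI_ex[of "\<lambda>vs. distinct vs \<and> set vs = pverts G"] by blast
  then show "distinct (vertex_list G)" "set (vertex_list G) = pverts G"
    "length (vertex_list G) = card (pverts G)"
    by (metis distinct_card)+
qed

lemma bij_betw_vertex_list:
  assumes "finite (pverts G)"
  shows "bij_betw ((!) (vertex_list G)) {0..<card (pverts G)} (pverts G)"
  by (rule bij_betw_nth) (simp_all add: vertex_list[OF assms] atLeast0LessThan)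

lemma sum_vertex_list:
  assumes "finite (pverts G)"
  shows "(\<Sum>i = 0..<card (pverts G). F (vertex_list G ! i)) = sum F (pverts G)"
  by (rule sum.reindex_bij_betw[OF bij_betw_vertex_list[OF assms]])

lemma vertex_list_nth_in:
  assumes "finite (pverts G)" "i < card (pverts G)"
  shows "vertex_list G ! i \<in> pverts G"
  using vertex_list[OF assms(1)] assms(2) by (metis nth_mem)

lemma ex_vec_of_vertices:
  assumes fin: "finite (pverts G)" and v: "v \<in> carrier_vec (card (pverts G))"
  obtains F where "v = vec (card (pverts G)) (\<lambda>i. F (vertex_list G ! i))"
proof
  let ?F = "\<lambda>u. v $ (the_inv_into {0..<card (pverts G)} ((!) (vertex_list G)) u)"
  show "v = vec (card (pverts G)) (\<lambda>i. ?F (vertex_list G ! i))"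
    using v by (intro eq_vecI)
      (simp_all add: the_inv_into_f_f[OF bij_betw_imp_inj_on[OF bij_betw_vertex_list[OF fin]]])
qed

lemma adjacency_matrix_carrier [simp]:
  "adjacency_matrix G \<in> carrier_mat (card (pverts G)) (card (pverts G))"
  by (simp add: adjacency_matrix_def)

lemma adjacency_matrix_mult_vec:
  fixes F :: "'a \<Rightarrow> 'k::comm_ring_1"
  assumes "finite (pverts G)" "i < card (pverts G)"
  shows "(adjacency_matrix G *\<^sub>v vec (card (pverts G)) (\<lambda>i. F (vertex_list G ! i))) $ i =
    (\<Sum>w\<in>pverts G. if (vertex_list G ! i, w) \<in> parcs G then F w else 0)"
proof -
  let ?u = "vertex_list G ! i"
  have "(adjacency_matrix G *\<^sub>v vec (card (pverts G)) (\<lambda>i. F (vertex_list G ! i))) $ i =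
    (\<Sum>j = 0..<card (pverts G). if (?u, vertex_list G ! j) \<in> parcs G
       then F (vertex_list G ! j) else 0)"
    using assms(2)
    by (auto simp: adjacency_matrix_def scalar_prod_def intro!: sum.cong)
  then show ?thesis
    using sum_vertex_list[OF assms(1), of "\<lambda>w. if (?u, w) \<in> parcs G then F w else 0"] by simp
qed

abbreviation fract_X :: "rat poly fract" where
  "fract_X \<equiv> to_fract [:0, 1:]"

abbreviation fract_char_matrix :: "'a pair_pre_digraph \<Rightarrow> rat poly fract mat" where
  "fract_char_matrix G \<equiv> map_mat to_fract (char_poly_matrix (adjacency_matrix G))"

lemma comm_ring_hom_to_fract: "comm_ring_hom (to_fract :: rat poly \<Rightarrow> _)"
  by unfold_locales auto

lemma fract_char_matrix_carrier [simp]: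
  "fract_char_matrix G \<in> carrier_mat (card (pverts G)) (card (pverts G))"
  by simp

lemma det_fract_char_matrix:
  "det (fract_char_matrix G) = to_fract (char_poly (adjacency_matrix G))"
proof -
  interpret comm_ring_hom "to_fract :: rat poly \<Rightarrow> _" by (rule comm_ring_hom_to_fract)
  show ?thesis by (simp add: char_poly_def)
qed

lemma char_poly_adjacency_nonzero: "char_poly (adjacency_matrix G :: 'k::comm_ring_1 mat) \<noteq> 0"
  using degree_monic_char_poly[OF adjacency_matrix_carrier] by (metis coeff_0 zero_neq_one)

text \<open>The characteristic polynomial is monic, so the determinant is nonzero in the fraction
  field; hence \<open>the\<close> in \<open>coronal\<close> is applied to a genuine inverse.\<close>

lemma coronal_inverse:
  assumes "finite (pverts G)"
  obtains y where "y \<in> carrier_vec (card (pverts G))"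
    "fract_char_matrix G *\<^sub>v y = all_ones G" "coronal G = all_ones G \<bullet> y"
proof -
  let ?n = "card (pverts G)"
  let ?M = "fract_char_matrix G"
  have "det ?M \<noteq> 0"
    by (simp add: det_fract_char_matrix char_poly_adjacency_nonzero)
  then have "?M \<in> Units (ring_mat TYPE(rat poly fract) ?n ())"
    by (intro det_non_zero_imp_unit) auto
  then obtain B where B: "mat_inverse ?M = Some B"
    using mat_inverse(1)[OF fract_char_matrix_carrier] by (metis option.exhaust)
  from mat_inverse(2)[OF fract_char_matrix_carrier this]
  have 1: "?M * B = 1\<^sub>m ?n" "B \<in> carrier_mat ?n ?n" by auto
  have ones: "(all_ones G :: rat poly fract vec) \<in> carrier_vec ?n" by (simp add: all_ones_def)
  show ?thesis
  proof
    show "B *\<^sub>v all_ones G \<in> carrier_vec ?n" using 1 ones by simp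
    show "?M *\<^sub>v (B *\<^sub>v all_ones G) = all_ones G"
      using assoc_mult_mat_vec[OF fract_char_matrix_carrier 1(2) ones] 1(1) ones by simp
    show "coronal G = all_ones G \<bullet> (B *\<^sub>v all_ones G)"
      by (simp add: coronal_def B)
  qed
qed

lemma fract_char_matrix_index:
  assumes "i < card (pverts G)" "j < card (pverts G)"
  shows "fract_char_matrix G $$ (i, j) =
    (if i = j then fract_X else 0) -
    (if (vertex_list G ! i, vertex_list G ! j) \<in> parcs G then 1 else 0)"
proof -
  \<comment> \<open>After simplification the entry is \<open>[:- 1:]\<close> at an off-diagonal arc
    and \<open>pCons (- 1) 1\<close>, that is x - 1, at a loop; loops are not excluded here.\<close>
  have "to_fract [:- 1:] = - (1 :: rat poly fract)"
    by (simp only: to_fract_uminus[symmetric] to_fract_1[symmetric] to_fract_eq_iff)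
       (simp add: one_pCons)
  moreover have "to_fract (pCons (- 1) 1) = fract_X - 1"
    by (simp only: to_fract_diff[symmetric] to_fract_1[symmetric] to_fract_eq_iff)
       (simp add: one_pCons)
  ultimately show ?thesis
    using assms by (simp add: char_poly_matrix_def adjacency_matrix_def)
qed

lemma fract_char_matrix_mult_vec:
  assumes "finite (pverts G)" "i < card (pverts G)"
  shows "(fract_char_matrix G *\<^sub>v vec (card (pverts G)) (\<lambda>i. F (vertex_list G ! i))) $ i =
    fract_X * F (vertex_list G ! i) -
    (\<Sum>w\<in>pverts G. if (vertex_list G ! i, w) \<in> parcs G then F w else 0)"
proof -
  let ?n = "card (pverts G)" and ?vl = "vertex_list G"
  define M where "M = fract_char_matrix G"
  have M: "M \<in> carrier_mat ?n ?n" by (simp add: M_def)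
  have idx: "M $$ (i, j) = (if i = j then fract_X else 0) -
      (if (?vl ! i, ?vl ! j) \<in> parcs G then 1 else 0)" if "j < ?n" for j
    unfolding M_def by (rule fract_char_matrix_index[OF assms(2) that])
  have "(M *\<^sub>v vec ?n (\<lambda>i. F (?vl ! i))) $ i =
     (\<Sum>j = 0..<?n. (if i = j then fract_X * F (?vl ! j) else 0) -
        (if (?vl ! i, ?vl ! j) \<in> parcs G then F (?vl ! j) else 0))"
    using assms(2) M by (auto simp: scalar_prod_def idx algebra_simps intro!: sum.cong)
  also have "\<dots> = fract_X * F (?vl ! i) -
     (\<Sum>j = 0..<?n. if (?vl ! i, ?vl ! j) \<in> parcs G then F (?vl ! j) else 0)"
    using assms(2) by (simp add: sum_subtractf)
  finally show ?thesis
    using sum_vertex_list[OF assms(1), of "\<lambda>w. if (?vl ! i, w) \<in> parcs G then F w else 0"]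
    by (simp add: M_def)
qed

lemma coronal_resolvent:
  assumes fin: "finite (pverts G)"
  obtains y where "resolvent_eq G fract_X 1 y" "coronal G = sum y (pverts G)"
proof -
  let ?n = "card (pverts G)"
  obtain v where v: "v \<in> carrier_vec ?n" "fract_char_matrix G *\<^sub>v v = all_ones G"
    "coronal G = all_ones G \<bullet> v"
    using coronal_inverse[OF fin] .
  obtain y where y: "v = vec ?n (\<lambda>i. y (vertex_list G ! i))"
    using ex_vec_of_vertices[OF fin v(1)] .
  have "resolvent_eq G fract_X 1 y"
    unfolding resolvent_eq_def
  proof
    fix u assume "u \<in> pverts G"
    then obtain i where i: "i < ?n" "u = vertex_list G ! i"
      using vertex_list[OF fin] by (metis in_set_conv_nth)
    have "(fract_char_matrix G *\<^sub>v v) $ i = 1"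
      using i by (simp add: v(2) all_ones_def)
    then show "fract_X * y u = 1 + (\<Sum>w\<in>pverts G. if (u, w) \<in> parcs G then y w else 0)"
      using fract_char_matrix_mult_vec[OF fin i(1)] by (simp add: y i(2) algebra_simps)
  qed
  moreover have "coronal G = sum y (pverts G)"
    using sum_vertex_list[OF fin, of y] by (simp add: v(3) y all_ones_def scalar_prod_def)
  ultimately show ?thesis by (rule that)
qed

lemma coronal_eq_sum:
  assumes "finite (pverts G)" "sym (parcs G)" "resolvent_eq G fract_X 1 y"
  shows "coronal G = sum y (pverts G)"
proof -
  obtain z where "resolvent_eq G fract_X 1 z" "coronal G = sum z (pverts G)"
    using coronal_resolvent[OF assms(1)] .
  then show ?thesis using resolvent_eq_sum[OF assms(2,3)] by simp
qed

section \<open>Clearing denominators, and properness of the coronal\<close>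

lemma common_denominator:
  fixes y :: "'a \<Rightarrow> 'k::idom fract"
  assumes "finite V"
  shows "\<exists>q N. q \<noteq> 0 \<and> (\<forall>u\<in>V. to_fract q * y u = to_fract (N u))"
  using assms
proof induction
  case (insert v V)
  then obtain q N where q: "q \<noteq> 0" "\<forall>u\<in>V. to_fract q * y u = to_fract (N u)" by auto
  obtain a b where ab: "y v = Fract a b" "b \<noteq> 0" by (cases "y v") auto
  have "to_fract (q * b) * y u = to_fract (if u = v then q * a else b * N u)"
    if "u \<in> insert v V" for u
  proof (cases "u = v")
    case True
    then show ?thesis using ab by (simp add: Fract_conv_to_fract field_simps)
  next
    case False
    then have "to_fract q * y u = to_fract (N u)" using q that by auto
    then show ?thesis using False by (simp add: mult_ac)
  qed
  moreover have "q * b \<noteq> 0" using q ab by simp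
  ultimately show ?case
    by (intro exI[of _ "q * b"] exI[of _ "\<lambda>u. if u = v then q * a else b * N u"]) simp
qed (auto intro: exI[of _ 1])

text \<open>Scaling the solution over the fraction field by a common denominator moves the equation
  into polynomials, where degrees and roots are available.\<close>

lemma coronal_polynomial_solution:
  assumes fin: "finite (pverts G)"
  obtains q N where "q \<noteq> 0" "resolvent_eq G [:0, 1:] q N"
    "coronal G = Fract (sum N (pverts G)) q"
proof -
  interpret comm_ring_hom "to_fract :: rat poly \<Rightarrow> _" by (rule comm_ring_hom_to_fract)
  obtain y where y: "resolvent_eq G fract_X 1 y" "coronal G = sum y (pverts G)"
    using coronal_resolvent[OF fin] .
  obtain q N where q: "q \<noteq> 0" "\<forall>u\<in>pverts G. to_fract q * y u = to_fract (N u)"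
    using common_denominator[OF fin, of y] by (elim exE conjE) (rule that)
  have "resolvent_eq G [:0, 1:] q N"
    unfolding resolvent_eq_def
  proof
    fix u assume u: "u \<in> pverts G"
    have "fract_X * (to_fract q * y u) = to_fract q +
        (\<Sum>w\<in>pverts G. if (u, w) \<in> parcs G then to_fract q * y w else 0)"
      using resolvent_eqD[OF resolvent_eq_mult[OF y(1), of "to_fract q"] u] by simp
    also have "(\<Sum>w\<in>pverts G. if (u, w) \<in> parcs G then to_fract q * y w else 0) =
        (\<Sum>w\<in>pverts G. to_fract (if (u, w) \<in> parcs G then N w else 0))"
      by (intro sum.cong) (simp_all add: q(2))
    finally have "to_fract ([:0, 1:] * N u) =
        to_fract (q + (\<Sum>w\<in>pverts G. if (u, w) \<in> parcs G then N w else 0))"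
      by (simp only: hom_mult hom_add hom_sum q(2)[rule_format, OF u])
    then show "[:0, 1:] * N u = q + (\<Sum>w\<in>pverts G. if (u, w) \<in> parcs G then N w else 0)"
      by (simp only: to_fract_eq_iff)
  qed
  moreover have "to_fract q * coronal G = to_fract (sum N (pverts G))"
    using q(2) by (simp only: y(2) sum_distrib_left hom_sum cong: sum.cong)
  then have "coronal G = Fract (sum N (pverts G)) q"
    using q(1) by (simp add: Fract_conv_to_fract field_simps)
  ultimately show ?thesis by (rule that[OF q(1)])
qed

text \<open>At a vertex where N has the largest degree d, the left side has degree d + 1 while the
  neighbour sum has degree at most d, so q has degree above d. This makes the coronal a proper
  fraction.\<close>

lemma resolvent_eq_degree:
  fixes q :: "'k::idom poly"
  assumes fin: "finite (pverts G)" and "q \<noteq> 0" and res: "resolvent_eq G [:0, 1:] q N"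
  shows "degree (sum N (pverts G)) < degree q \<or> sum N (pverts G) = 0"
proof (cases "\<forall>u\<in>pverts G. N u = 0")
  case False
  let ?D = "(degree \<circ> N) ` {u \<in> pverts G. N u \<noteq> 0}"
  have "finite ?D" "?D \<noteq> {}" using fin False by auto
  then have "Max ?D \<in> ?D" by (rule Max_in)
  then obtain u where u: "u \<in> pverts G" "N u \<noteq> 0" "degree (N u) = Max ?D" by auto
  have le: "degree (N w) \<le> degree (N u)" if "w \<in> pverts G" for w
    using \<open>finite ?D\<close> that by (cases "N w = 0") (auto simp: u(3))
  have "degree (sum N (pverts G)) \<le> degree (N u)"
    using fin le by (intro degree_sum_le) auto
  moreover have "degree (N u) < degree q"
  proof (rule ccontr)
    assume "\<not> degree (N u) < degree q"
    then have "degree (q + (\<Sum>w\<in>pverts G. if (u, w) \<in> parcs G then N w else 0)) \<le> degree (N u)"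
      using fin le by (intro degree_add_le degree_sum_le) auto
    then have "degree ([:0, 1:] * N u) \<le> degree (N u)"
      by (simp only: resolvent_eqD[OF res u(1)])
    then show False using u(2) by (simp add: degree_mult_eq)
  qed
  ultimately show ?thesis by simp
qed auto

section \<open>Main eigenvalues\<close>

interpretation rat_complex_poly_hom: map_poly_inj_comm_ring_hom "of_rat :: rat \<Rightarrow> complex" ..

text \<open>Pairing with the conjugate of w = N(l) and cancelling x - l leaves an identity whose
  value at l is \<open>S = poly h l * cnj (sum w (pverts G))\<close>. As S is the squared norm of w,
  both factors are nonzero: the first says that l is a simple root, the second that l is
  main.\<close>

lemma resolvent_eq_root:
  fixes N :: "'a \<Rightarrow> complex poly"
  assumes fin: "finite (pverts G)" and sym: "sym (parcs G)"
    and res: "resolvent_eq G [:0, 1:] ([:- l, 1:] * h) N"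
    and nz: "u \<in> pverts G" "poly (N u) l \<noteq> 0"
  shows "main_eigenvalue G l" "poly h l \<noteq> 0"
proof -
  let ?n = "card (pverts G)" and ?vl = "vertex_list G"
  define w where "w u = poly (N u) l" for u
  define S where "S = (\<Sum>u\<in>pverts G. cnj (w u) * w u)"
  have S: "S \<noteq> 0"
  proof -
    have "S = of_real (\<Sum>u\<in>pverts G. (cmod (w u))\<^sup>2)"
      unfolding S_def of_real_sum
      by (rule sum.cong) (simp_all only: complex_norm_square mult.commute)
    moreover have "(\<Sum>u\<in>pverts G. (cmod (w u))\<^sup>2) > 0"
      using fin nz by (intro sum_pos2[of _ u]) (auto simp: w_def)
    ultimately show ?thesis by (metis of_real_eq_0_iff less_irrefl)
  qed
  have ev: "comm_ring_hom (\<lambda>p. poly p l)" and cj: "comm_ring_hom cnj"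
    and const: "comm_ring_hom (\<lambda>c :: complex. [:c:])"
    by (unfold_locales; simp add: one_pCons)+
  have w: "resolvent_eq G l 0 w"
    using comm_ring_hom.resolvent_eq_hom[OF ev res] by (simp add: w_def[abs_def])
  have cw: "resolvent_eq G (cnj l) 0 (\<lambda>u. cnj (w u))"
    using comm_ring_hom.resolvent_eq_hom[OF cj w] by simp
  \<comment> \<open>The eigenvalue is real, so the conjugate of w is an eigenvector for l itself and
    not only for \<open>cnj l\<close>.\<close>
  have "(l - cnj l) * S = 0"
    using resolvent_eq_bilinear[OF sym w cw] by (simp add: S_def)
  with S have real: "cnj l = l" by simp
  \<comment> \<open>Read as constant polynomials, w can be paired with N: the parameters are now the
    variable and the constant l.\<close>
  have "resolvent_eq G [:l:] 0 (\<lambda>u. [:cnj (w u):])"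
    using comm_ring_hom.resolvent_eq_hom[OF const cw] by (simp add: real)
  from resolvent_eq_bilinear[OF sym res this]
  have "([:0, 1:] - [:l:]) * (\<Sum>u\<in>pverts G. [:cnj (w u):] * N u) =
      [:- l, 1:] * h * (\<Sum>u\<in>pverts G. [:cnj (w u):])"
    by simp
  moreover have "[:0, 1:] - [:l:] = [:- l, 1:]" by simp
  ultimately have "[:- l, 1:] * (\<Sum>u\<in>pverts G. [:cnj (w u):] * N u) =
      [:- l, 1:] * (h * (\<Sum>u\<in>pverts G. [:cnj (w u):]))"
    by (simp only: mult.assoc)
  then have "(\<Sum>u\<in>pverts G. [:cnj (w u):] * N u) = h * (\<Sum>u\<in>pverts G. [:cnj (w u):])"
    by (subst (asm) mult_left_cancel) auto
  from arg_cong[OF this, of "\<lambda>p. poly p l"]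
  have eq: "S = poly h l * cnj (sum w (pverts G))"
    by (simp add: S_def w_def poly_sum)
  with S show "poly h l \<noteq> 0" by auto
  from eq S have sum: "sum w (pverts G) \<noteq> 0" by (metis complex_cnj_zero mult_zero_right)
  define v where "v = vec ?n (\<lambda>i. w (?vl ! i))"
  have ones: "all_ones G \<bullet> v = sum w (pverts G)"
    using sum_vertex_list[OF fin, of w] by (simp add: all_ones_def v_def scalar_prod_def)
  have "(adjacency_matrix G *\<^sub>v v) $ i = (l \<cdot>\<^sub>v v) $ i" if "i < ?n" for i
    using adjacency_matrix_mult_vec[OF fin that, of w]
      resolvent_eqD[OF w vertex_list_nth_in[OF fin that]] that
    by (simp add: v_def)
  then have "adjacency_matrix G *\<^sub>v v = l \<cdot>\<^sub>v v"
    by (intro eq_vecI) (simp_all add: v_def adjacency_matrix_def)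
  moreover have "v \<noteq> 0\<^sub>v ?n"
    using ones sum by (auto simp: all_ones_def)
  ultimately have "eigenvector (adjacency_matrix G) v l"
    by (simp add: eigenvector_def v_def adjacency_matrix_def)
  then show "main_eigenvalue G l"
    using ones sum unfolding main_eigenvalue_def by metis
qed

text \<open>Finiteness matters because \<open>main_poly\<close> is a product over this set, and a
  product over an infinite set is 1 by convention.\<close>

lemma finite_main_eigenvalues: "finite {l. main_eigenvalue G l}"
proof (rule finite_subset)
  let ?A = "adjacency_matrix G :: complex mat"
  show "{l. main_eigenvalue G l} \<subseteq> {l. poly (char_poly ?A) l = 0}"
    using eigenvalue_root_char_poly[OF adjacency_matrix_carrier, of G]
    by (auto simp: main_eigenvalue_def eigenvalue_def)
  show "finite {l. poly (char_poly ?A) l = 0}"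
    by (rule poly_roots_finite[OF char_poly_adjacency_nonzero])
qed

lemma resolvent_eq_cancel:
  fixes p :: "'k::idom poly"
  assumes "resolvent_eq G x (c * p) (\<lambda>u. c * N u)" "c \<noteq> 0"
  shows "resolvent_eq G x p N"
  unfolding resolvent_eq_def
proof
  fix u assume "u \<in> pverts G"
  from resolvent_eqD[OF assms(1) this]
  have "c * (x * N u) = c * (p + (\<Sum>w\<in>pverts G. if (u, w) \<in> parcs G then N w else 0))"
    by (simp add: sum_distrib_left distrib_left mult.left_commute if_distrib[of "(*) c"] cong: if_cong)
  then show "x * N u = p + (\<Sum>w\<in>pverts G. if (u, w) \<in> parcs G then N w else 0)"
    using assms(2) by simp
qed

lemma resolvent_eq_cong:
  assumes "\<And>u. u \<in> pverts G \<Longrightarrow> N u = L u"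
  shows "resolvent_eq G x p N \<longleftrightarrow> resolvent_eq G x p L"
proof -
  have "(\<Sum>w\<in>pverts G. if (u, w) \<in> parcs G then N w else 0) =
      (\<Sum>w\<in>pverts G. if (u, w) \<in> parcs G then L w else 0)" for u
    using assms by (intro sum.cong) auto
  then show ?thesis using assms by (simp add: resolvent_eq_def)
qed

text \<open>A solution whose right-hand side has least degree cannot be divided by a linear factor, so
  by \<open>resolvent_eq_root\<close> its right-hand side has only simple roots, all of them main.\<close>

lemma resolvent_eq_main_poly:
  fixes p :: "complex poly"
  assumes fin: "finite (pverts G)" and sym: "sym (parcs G)"
    and "p \<noteq> 0" "resolvent_eq G [:0, 1:] p N"
  obtains L where "resolvent_eq G [:0, 1:] (main_poly G) L"
proof -
  let ?P = "\<lambda>p :: complex poly. p \<noteq> 0 \<and> (\<exists>N. resolvent_eq G [:0, 1:] p N)"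
  have "?P p" using assms by blast
  then obtain p where "?P p" and min: "\<And>q. ?P q \<Longrightarrow> degree p \<le> degree q"
    using ex_has_least_nat[of ?P p degree] by blast
  then obtain N where p: "p \<noteq> 0" "resolvent_eq G [:0, 1:] p N" by blast
  have root: "main_eigenvalue G l \<and> order l p = 1" if l: "poly p l = 0" for l
  proof -
    obtain h where h: "p = [:- l, 1:] * h"
      using l by (auto simp: poly_eq_0_iff_dvd)
    then have "h \<noteq> 0" using p(1) by auto
    have "\<exists>u\<in>pverts G. poly (N u) l \<noteq> 0"
    proof (rule ccontr)
      assume "\<not> (\<exists>u\<in>pverts G. poly (N u) l \<noteq> 0)"
      then have "\<forall>u. \<exists>k. u \<in> pverts G \<longrightarrow> N u = [:- l, 1:] * k"
        by (metis poly_eq_0_iff_dvd dvdE)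
      then obtain K where K: "\<And>u. u \<in> pverts G \<Longrightarrow> N u = [:- l, 1:] * K u"
        by metis
      have "resolvent_eq G [:0, 1:] ([:- l, 1:] * h) (\<lambda>u. [:- l, 1:] * K u)"
        using p(2) resolvent_eq_cong[of G N "\<lambda>u. [:- l, 1:] * K u", OF K] by (simp only: h)
      then have "resolvent_eq G [:0, 1:] h K"
        by (rule resolvent_eq_cancel) simp
      then have "degree p \<le> degree h"
        using min[of h] \<open>h \<noteq> 0\<close> by blast
      moreover have "degree p = Suc (degree h)"
        unfolding h using \<open>h \<noteq> 0\<close> by (subst degree_mult_eq) auto
      ultimately show False by simp
    qed
    then obtain u where u: "u \<in> pverts G" "poly (N u) l \<noteq> 0" by blast
    have res: "resolvent_eq G [:0, 1:] ([:- l, 1:] * h) N" using p(2) by (simp only: h)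
    \<comment> \<open>The explicit linear factor contributes 1, and h contributes 0 since it does
      not vanish at l.\<close>
    have "order l p = order l [:- l, 1:] + order l h"
      unfolding h by (rule order_mult) (use p(1) h in simp)
    also have "order l h = 0"
      by (rule order_0I) (rule resolvent_eq_root(2)[OF fin sym res u])
    also have "order l [:- l, 1:] = 1"
      using order_power_n_n[of l 1] by simp
    finally show ?thesis
      using resolvent_eq_root(1)[OF fin sym res u] by simp
  qed
  then have "rsquarefree p"
    using p(1) by (auto simp: rsquarefree_def order_root)
  \<comment> \<open>Up to its nonzero leading coefficient, p is the product of x - z over its roots
    z, all of which are main.\<close>
  from complex_poly_decompose_rsquarefree[OF this]
  have "p dvd (\<Prod>z | poly p z = 0. [:- z, 1:])"
    using p(1) by (metis smult_dvd_iff dvd_refl leading_coeff_0_iff)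
  also have "\<dots> dvd main_poly G"
    unfolding main_poly_def using root
    by (intro prod_dvd_prod_subset finite_main_eigenvalues) auto
  finally obtain k where "main_poly G = k * p" by (metis dvdE mult.commute)
  then show ?thesis
    using resolvent_eq_mult[OF p(2), of k] that by metis
qed

text \<open>Comparing the rational solution with the complex one for the main polynomial gives q *
  sum L = F * sum N, so F clears the denominator q. Positive degree of F keeps the degree bound
  strict for the numerator 0.\<close>

lemma coronal_denominator:
  assumes fin: "finite (pverts G)" and sym: "sym (parcs G)"
    and main: "main_poly G = map_poly of_rat F" and F: "degree F > 0"
  obtains A where "coronal G = Fract A F" "degree A < degree F"
proof -
  obtain q N where q: "q \<noteq> 0" "resolvent_eq G [:0, 1:] q N"
    and cor: "coronal G = Fract (sum N (pverts G)) q"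
    using coronal_polynomial_solution[OF fin] .
  let ?h = "map_poly (of_rat :: rat \<Rightarrow> complex)"
  let ?S = "sum N (pverts G)"
  have res: "resolvent_eq G [:0, 1:] (?h q) (\<lambda>u. ?h (N u))"
    using rat_complex_poly_hom.resolvent_eq_hom[OF q(2)] by simp
  obtain L where L: "resolvent_eq G [:0, 1:] (main_poly G) L"
    by (rule resolvent_eq_main_poly[OF fin sym _ res]) (use q(1) in auto)
  have "?h q * sum L (pverts G) = ?h F * (\<Sum>u\<in>pverts G. ?h (N u))"
    using resolvent_eq_sum[OF sym res L] by (simp only: main)
  also have "\<dots> = ?h (F * ?S)"
    by (simp only: rat_complex_poly_hom.hom_mult rat_complex_poly_hom.hom_sum)
  finally have "?h q dvd ?h (F * ?S)" by (metis dvd_triv_left)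
  \<comment> \<open>The cofactor \<open>sum L\<close> is only known to be complex, but divisibility
    between rational polynomials descends from the complex numbers.\<close>
  then have "q dvd F * ?S" by (rule of_rat_hom.dvd_map_poly_hom_imp_dvd)
  then obtain A where A: "F * ?S = q * A" by (rule dvdE)
  have "F \<noteq> 0" using F by auto
  show ?thesis
  proof
    show "coronal G = Fract A F"
      using q(1) \<open>F \<noteq> 0\<close> A by (simp add: cor eq_fract mult_ac)
    show "degree A < degree F"
    proof (cases "A = 0")
      case False
      then have "?S \<noteq> 0" using A q(1) by auto
      then have "degree ?S < degree q"
        using resolvent_eq_degree[OF fin q] by simp
      moreover have "degree F + degree ?S = degree q + degree A"
        using arg_cong[OF A, of degree] False q(1) \<open>F \<noteq> 0\<close> \<open>?S \<noteq> 0\<close>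
        by (simp add: degree_mult_eq)
      ultimately show ?thesis by simp
    qed (use F in simp)
  qed
qed

section \<open>Connected components\<close>

lemma pair_graph_finite_sym:
  assumes "pair_graph G"
  shows "finite (pverts G)" "sym (parcs G)"
proof -
  interpret pair_graph G by fact
  show "finite (pverts G)" by (rule pair_finite_verts)
  show "sym (parcs G)" using pair_sym_arcs by (auto simp: symmetric_def)
qed

text \<open>Arcs come in opposite pairs, so the ends of an arc reach each other and lie in the same
  strong component. Thus the rows of H at vertices of C are the rows of C.\<close>

lemma component_closed:
  assumes "pair_graph H" "with_proj C \<in> pre_digraph.sccs (with_proj H)"
  shows "pverts C \<subseteq> pverts H"
    and "u \<in> pverts C \<Longrightarrow> (u, w) \<in> parcs H \<longleftrightarrow> (u, w) \<in> parcs C"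
    and "u \<in> pverts C \<Longrightarrow> (u, w) \<in> parcs H \<Longrightarrow> w \<in> pverts C"
proof -
  interpret pair_graph H by fact
  have ind: "induced_subgraph (with_proj C) (with_proj H)"
    using assms(2) by (rule in_sccs_imp_induced)
  then have "subgraph (with_proj C) (with_proj H)" by (simp add: induced_subgraph_def)
  then show "pverts C \<subseteq> pverts H" by (simp add: subgraph_def)
  have arcs: "parcs C = {e \<in> parcs H. fst e \<in> pverts C \<and> snd e \<in> pverts C}"
    using ind by (simp add: induced_subgraph_def)
  have "verts (with_proj C) \<in> sccs_verts"
    unfolding sccs_verts_conv using assms(2) by (rule imageI)
  then have verts: "pverts C \<in> sccs_verts" by simp
  have closed: "w \<in> pverts C" if "u \<in> pverts C" "(u, w) \<in> parcs H" for u w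
  proof (rule ccontr)
    assume "w \<notin> pverts C"
    moreover have "(w, u) \<in> parcs H"
      using pair_graph_finite_sym(2)[OF assms(1)] that(2) by (rule symD)
    then have "w \<rightarrow>\<^sup>*\<^bsub>with_proj H\<^esub> u" by (intro reachable_adjI) simp
    moreover have "u \<rightarrow>\<^sup>*\<^bsub>with_proj H\<^esub> w" using that(2) by (intro reachable_adjI) simp
    ultimately show False
      using verts that(1) unfolding in_sccs_verts_conv_reachable by metis
  qed
  then show "u \<in> pverts C \<Longrightarrow> (u, w) \<in> parcs H \<Longrightarrow> w \<in> pverts C" .
  show "(u, w) \<in> parcs H \<longleftrightarrow> (u, w) \<in> parcs C" if "u \<in> pverts C"
    unfolding arcs using closed[OF that] that by auto
qed

lemma finite_sym_component:
  assumes "pair_graph H" "with_proj C \<in> pre_digraph.sccs (with_proj H)"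
  shows "finite (pverts C)" "sym (parcs C)"
proof -
  note H = pair_graph_finite_sym[OF assms(1)] and closed = component_closed[OF assms]
  show "finite (pverts C)"
    using H(1) closed(1) by (rule rev_finite_subset)
  interpret pair_graph H by fact
  have "induced_subgraph (with_proj C) (with_proj H)"
    using assms(2) by (rule in_sccs_imp_induced)
  then have "parcs C = {e \<in> parcs H. fst e \<in> pverts C \<and> snd e \<in> pverts C}"
    by (simp add: induced_subgraph_def)
  then show "sym (parcs C)" using H(2) by (auto simp: sym_def)
qed

lemma resolvent_eq_component:
  assumes "pair_graph H" "with_proj C \<in> pre_digraph.sccs (with_proj H)"
    and "resolvent_eq H x p N"
  shows "resolvent_eq C x p N"
  unfolding resolvent_eq_def
proof
  note closed = component_closed[OF assms(1,2)]
  fix u assume u: "u \<in> pverts C"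
  have "(\<Sum>w\<in>pverts H. if (u, w) \<in> parcs H then N w else 0) =
      (\<Sum>w\<in>pverts C. if (u, w) \<in> parcs C then N w else 0)"
    using closed(1) closed(2)[OF u] closed(3)[OF u] pair_graph_finite_sym(1)[OF assms(1)]
    by (intro sum.mono_neutral_cong_right) auto
  then show "x * N u = p + (\<Sum>w\<in>pverts C. if (u, w) \<in> parcs C then N w else 0)"
    using resolvent_eqD[OF assms(3)] closed(1) u by auto
qed

text \<open>One solution on H restricts to solutions on R and on U, and its total splits over the
  two disjoint vertex sets.\<close>

lemma coronal_two_components:
  assumes H: "pair_graph H"
    and sccs: "pre_digraph.sccs (with_proj H) = {with_proj R, with_proj U}" and "R \<noteq> U"
  shows "coronal H = coronal R + coronal U"
proof -
  interpret pair_graph H by fact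
  note fs = pair_graph_finite_sym[OF H]
  have R: "with_proj R \<in> sccs" and U: "with_proj U \<in> sccs" using sccs by auto
  \<comment> \<open>\<open>with_proj\<close> is injective, which turns distinctness of R and U into
    distinctness of strong components.\<close>
  have "with_proj R \<noteq> with_proj U"
    using \<open>R \<noteq> U\<close> by (auto simp: with_proj_def intro: pair_pre_digraph.equality)
  from scc_disj[OF R U this] have disj: "pverts R \<inter> pverts U = {}" by simp
  have "u \<in> pverts R \<union> pverts U" if "u \<in> pverts H" for u
  proof -
    have "u \<in> scc_of u" using that by (intro in_scc_of_self) simp
    moreover have "scc_of u \<in> verts ` sccs"
      using scc_of_in_sccs_verts[of u] that by (simp add: sccs_verts_conv)
    ultimately show ?thesis using sccs by auto
  qed
  then have union: "pverts H = pverts R \<union> pverts U"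
    using component_closed(1)[OF H R] component_closed(1)[OF H U] by auto
  obtain y where y: "resolvent_eq H fract_X 1 y" "coronal H = sum y (pverts H)"
    using coronal_resolvent[OF fs(1)] .
  have "coronal R = sum y (pverts R)" "coronal U = sum y (pverts U)"
    using coronal_eq_sum[OF finite_sym_component[OF H R] resolvent_eq_component[OF H R y(1)]]
      coronal_eq_sum[OF finite_sym_component[OF H U] resolvent_eq_component[OF H U y(1)]] .
  then show ?thesis
    unfolding y(2) union using disj finite_sym_component(1)[OF H R] finite_sym_component(1)[OF H U]
    by (simp add: sum.union_disjoint)
qed

section \<open>Generalized cospectral graphs have equal coronals\<close>

text \<open>Both block products below have the determinant of \<open>B\<close>: \<open>E\<close> is unitriangular.\<close>

lemma det_one_plus_outer_product:
  fixes c r :: "'k::idom mat"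
  assumes c: "c \<in> carrier_mat n 1" and r: "r \<in> carrier_mat 1 n"
  shows "det (c * r + 1\<^sub>m n) = 1 + (r * c) $$ (0, 0)"
proof -
  define B where "B = four_block_mat (1\<^sub>m 1) (- r) c (1\<^sub>m n)"
  define E where "E = four_block_mat (1\<^sub>m 1) r (0\<^sub>m n 1) (1\<^sub>m n)"
  have B: "B \<in> carrier_mat (1 + n) (1 + n)" and E: "E \<in> carrier_mat (1 + n) (1 + n)"
    unfolding B_def E_def by (intro four_block_carrier_mat; simp)+
  have detE: "det E = 1"
    unfolding E_def by (subst det_four_block_mat_lower_left_zero[OF _ r]) auto
  \<comment> \<open>On either side E clears the upper right block of B; on the right it leaves the n
    by n Schur complement, on the left the 1 by 1 one.\<close>
  have "B * E = four_block_mat (1\<^sub>m 1) (0\<^sub>m 1 n) c (c * r + 1\<^sub>m n)"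
    unfolding B_def E_def using c r
    by (subst mult_four_block_mat[where ?n1.0 = 1 and ?n2.0 = n and ?nc1.0 = 1 and ?nc2.0 = n
            and ?nr1.0 = 1 and ?nr2.0 = n])
       (auto simp: uminus_l_inv_mat comm_add_mat[of r 1 n "- r"])
  then have "det (B * E) = det (1\<^sub>m 1 :: 'k mat) * det (c * r + 1\<^sub>m n)"
    by (simp only:) (rule det_four_block_mat_upper_right_zero, use c r in auto)
  moreover have "E * B = four_block_mat (1\<^sub>m 1 + r * c) (0\<^sub>m 1 n) c (1\<^sub>m n)"
    unfolding B_def E_def using c r
    by (subst mult_four_block_mat[where ?n1.0 = 1 and ?n2.0 = n and ?nc1.0 = 1 and ?nc2.0 = n
            and ?nr1.0 = 1 and ?nr2.0 = n])
       (auto simp: uminus_l_inv_mat comm_add_mat[of r 1 n "- r"])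
  then have "det (E * B) = det (1\<^sub>m 1 + r * c) * det (1\<^sub>m n :: 'k mat)"
    by (simp only:) (rule det_four_block_mat_upper_right_zero, use c r in auto)
  moreover have "det (1\<^sub>m 1 + r * c) = 1 + (r * c) $$ (0, 0)"
    using c r by (subst det_single) auto
  moreover have "det (B * E) = det (E * B)"
    using B E by (simp add: det_mult mult.commute)
  ultimately show ?thesis by simp
qed

text \<open>With y as a column c and ones as a row r, M c r is the all-one matrix J, so M + J = M (c
  r + I).\<close>

lemma det_add_all_ones:
  fixes M :: "'k::idom mat"
  assumes M: "M \<in> carrier_mat n n" and y: "y \<in> carrier_vec n" and My: "M *\<^sub>v y = vec n (\<lambda>_. 1)"
  shows "det (M + mat n n (\<lambda>_. 1)) = det M * (1 + vec n (\<lambda>_. 1) \<bullet> y)"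
proof -
  define c where "c = mat n 1 (\<lambda>(i, _). y $ i)"
  define r :: "'k mat" where "r = mat 1 n (\<lambda>_. 1)"
  have c: "c \<in> carrier_mat n 1" and r: "r \<in> carrier_mat 1 n" by (simp_all add: c_def r_def)
  have "M * c = mat n 1 (\<lambda>_. 1)"
  proof (rule eq_matI)
    fix i j assume ij: "i < dim_row (mat n 1 (\<lambda>_. 1 :: 'k))" "j < dim_col (mat n 1 (\<lambda>_. 1 :: 'k))"
    have "col c j = y" using ij y by (intro eq_vecI) (auto simp: c_def)
    then have "(M * c) $$ (i, j) = (M *\<^sub>v y) $ i" using ij M c by simp
    then show "(M * c) $$ (i, j) = mat n 1 (\<lambda>_. 1) $$ (i, j)" using ij by (simp add: My)
  qed (use M c in auto)
  then have "M * c * r = mat n n (\<lambda>_. 1)"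
    by (intro eq_matI) (auto simp: r_def scalar_prod_def)
  then have "M * (c * r + 1\<^sub>m n) = mat n n (\<lambda>_. 1) + M"
    using M c r by (subst mult_add_distrib_mat[of _ n n _ n]) (auto simp: assoc_mult_mat[of M n n c 1 r n])
  also have "\<dots> = M + mat n n (\<lambda>_. 1)" using M by (intro comm_add_mat) auto
  finally have "det (M + mat n n (\<lambda>_. 1)) = det M * det (c * r + 1\<^sub>m n)"
    using M c r by (metis add_carrier_mat det_mult one_carrier_mat)
  moreover have "(r * c) $$ (0, 0) = vec n (\<lambda>_. 1) \<bullet> y"
    using y by (auto simp: r_def c_def scalar_prod_def)
  ultimately show ?thesis by (simp add: det_one_plus_outer_product[OF c r])
qed

lemma pverts_complement [simp]: "pverts (complement G) = pverts G"
  by (simp add: complement_def)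

lemma vertex_list_complement [simp]: "vertex_list (complement G) = vertex_list G"
  by (simp add: vertex_list_def)

text \<open>The complement has adjacency matrix \<open>J - I - A\<close>, so the substitution \<open>x \<mapsto> -1 - x\<close> turns
  its characteristic matrix into \<open>-(xI - A + J)\<close>.\<close>

lemma char_poly_complement:
  assumes "pair_graph G"
  shows "to_fract (char_poly (adjacency_matrix (complement G)) \<circ>\<^sub>p [:- 1, - 1:]) =
    (- 1) ^ card (pverts G) * (to_fract (char_poly (adjacency_matrix G)) * (1 + coronal G))"
proof -
  interpret pair_graph G by fact
  let ?n = "card (pverts G)" and ?vl = "vertex_list G"
  have fin: "finite (pverts G)" by (rule pair_finite_verts)
  \<comment> \<open>Substitution and embedding form a single ring homomorphism, so they commute with
    the determinant.\<close>
  define h where "h p = to_fract (p \<circ>\<^sub>p [:- 1, - 1:])" for p :: "rat poly"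
  have h: "comm_ring_hom h"
    by unfold_locales (simp_all add: h_def pcompose_add pcompose_mult pcompose_1)
  define M where "M = fract_char_matrix G"
  have M: "M \<in> carrier_mat ?n ?n" by (simp add: M_def)
  let ?J = "mat ?n ?n (\<lambda>_. 1 :: rat poly fract)"
  let ?C = "char_poly_matrix (adjacency_matrix (complement G) :: rat mat)"
  have "h [:0, 1:] = to_fract (- [:0, 1:] - 1)" "h [:- 1:] = to_fract (- 1)"
    by (simp_all add: h_def pcompose_pCons one_pCons)
  then have h_simps: "h [:0, 1:] = - fract_X - 1" "h [:- 1:] = - 1"
    by (simp_all only: to_fract_diff to_fract_uminus to_fract_1)
  have h_0: "h 0 = 0" by (simp add: h_def)
  have C: "?C $$ (i, j) = (if i = j then [:0, 1:] else
      if (?vl ! i, ?vl ! j) \<in> parcs G then 0 else [:- 1:])"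
    if "i < ?n" "j < ?n" for i j
  proof -
    have "?vl ! i \<in> pverts G" "?vl ! j \<in> pverts G"
      using that vertex_list_nth_in[OF fin] by auto
    moreover have "?vl ! i = ?vl ! j \<longleftrightarrow> i = j"
      using that vertex_list[OF fin] by (simp add: nth_eq_iff_index_eq)
    ultimately show ?thesis
      using that by (auto simp: char_poly_matrix_def adjacency_matrix_def complement_def
          vertex_list_complement[unfolded complement_def])
  qed
  have M_idx: "M $$ (i, j) = (if i = j then fract_X else
      if (?vl ! i, ?vl ! j) \<in> parcs G then - 1 else 0)" if "i < ?n" "j < ?n" for i j
    unfolding M_def fract_char_matrix_index[OF that]
    using pair_no_loops[of "(?vl ! i, ?vl ! i)"] by auto
  \<comment> \<open>Entrywise: the diagonal gives -x - 1, an arc of G gives 0 = -(-1 + 1), and a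
    non-arc off the diagonal gives -1 = -(0 + 1).\<close>
  have "map_mat h ?C = (- 1) \<cdot>\<^sub>m (M + ?J)"
  proof (rule eq_matI)
    fix i j assume "i < dim_row ((- 1) \<cdot>\<^sub>m (M + ?J))" "j < dim_col ((- 1) \<cdot>\<^sub>m (M + ?J))"
    then have ij: "i < ?n" "j < ?n" by simp_all
    moreover have "?C \<in> carrier_mat ?n ?n"
      using char_poly_matrix_closed[OF adjacency_matrix_carrier, of "complement G"] by simp
    ultimately show "map_mat h ?C $$ (i, j) = ((- 1) \<cdot>\<^sub>m (M + ?J)) $$ (i, j)"
      using M C[OF ij] M_idx[OF ij] by (auto simp: h_simps h_0)
  qed (use M in \<open>simp_all add: char_poly_matrix_def adjacency_matrix_def\<close>)
  moreover have "h (char_poly (adjacency_matrix (complement G))) = det (map_mat h ?C)"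
    by (simp add: char_poly_def comm_ring_hom.hom_det[OF h])
  ultimately have "h (char_poly (adjacency_matrix (complement G))) = (- 1) ^ ?n * det (M + ?J)"
    using M by simp
  moreover obtain y where y: "y \<in> carrier_vec ?n" "M *\<^sub>v y = all_ones G"
    "coronal G = all_ones G \<bullet> y"
    using coronal_inverse[OF fin] unfolding M_def .
  have "det (M + ?J) = det M * (1 + coronal G)"
    using det_add_all_ones[OF M y(1)] y(2,3) by (simp add: all_ones_def)
  ultimately show ?thesis
    by (simp only: h_def M_def det_fract_char_matrix)
qed

text \<open>A monic complex polynomial is determined by its multiset of roots, and the embedding of
  rational polynomials is injective.\<close>

lemma char_poly_eq_of_adjacency_spectrum:
  assumes "adjacency_spectrum G = adjacency_spectrum H"
  shows "char_poly (adjacency_matrix G :: rat mat) = char_poly (adjacency_matrix H)"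
proof -
  have lead: "lead_coeff (char_poly (adjacency_matrix K :: complex mat)) = 1"
for K :: "'c pair_pre_digraph"
    using degree_monic_char_poly[OF adjacency_matrix_carrier, of K] by metis
  have rat: "char_poly (adjacency_matrix K :: complex mat) =
      map_poly of_rat (char_poly (adjacency_matrix K))" for K :: "'c pair_pre_digraph"
  proof -
    have "(adjacency_matrix K :: complex mat) = map_mat of_rat (adjacency_matrix K)"
      by (intro eq_matI) (auto simp: adjacency_matrix_def)
    then show ?thesis by (simp only: of_rat_hom.char_poly_hom[OF adjacency_matrix_carrier])
  qed
  have "char_poly (adjacency_matrix G :: complex mat) = char_poly (adjacency_matrix H)"
    using assms complex_poly_decompose_multiset[of "char_poly (adjacency_matrix G)"]
      complex_poly_decompose_multiset[of "char_poly (adjacency_matrix H)"] lead[of G] lead[of H]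
    unfolding adjacency_spectrum_def by metis
  then show ?thesis
    by (simp only: rat rat_complex_poly_hom.eq_iff)
qed

text \<open>The orders agree as degrees of the characteristic polynomials, so the signs in
  \<open>char_poly_complement\<close> agree; cancelling the nonzero characteristic polynomial leaves
  1 plus the coronal.\<close>

lemma coronal_eq_of_generalized_cospectral:
  assumes "pair_graph G" "pair_graph H" "generalized_cospectral G H"
  shows "coronal G = coronal H"
proof -
  have eq: "char_poly (adjacency_matrix G :: rat mat) = char_poly (adjacency_matrix H)"
    "char_poly (adjacency_matrix (complement G) :: rat mat) =
      char_poly (adjacency_matrix (complement H))"
    using assms(3) by (auto simp: generalized_cospectral_def
        intro: char_poly_eq_of_adjacency_spectrum)
  then have "card (pverts G) = card (pverts H)"
    using degree_monic_char_poly[OF adjacency_matrix_carrier] by metis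
  then show ?thesis
    using char_poly_complement[OF assms(1)] char_poly_complement[OF assms(2)] eq
    by (simp add: char_poly_adjacency_nonzero)
qed

section \<open>Partial fractions\<close>

text \<open>By coprimality f divides A - A', whose degree is below that of f.\<close>

lemma partial_fractions_unique:
  fixes f g :: "'k::field_gcd poly"
  assumes "coprime f g"
    and eq: "A * g + B * f = A' * g + B' * f"
    and "degree A < degree f" "degree A' < degree f"
  shows "A = A'" "B = B'"
proof -
  have eq': "(A - A') * g = (B' - B) * f" using eq by (simp add: algebra_simps)
  then have "f dvd (A - A') * g" by simp
  then have "f dvd A - A'" using assms(1) by (simp add: coprime_dvd_mult_left_iff)
  moreover have "degree (A - A') < degree f" using assms(3,4) by (rule degree_diff_less)
  ultimately show "A = A'" by (auto dest: dvd_imp_degree_le)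
  with eq' assms(3) show "B = B'" by auto
qed

lemma partial_fractions_exist:
  fixes f g P :: "'k::field_gcd poly"
  assumes "coprime f g" "degree f > 0" "degree g > 0" "degree P < degree f + degree g"
  obtains A B where "P = A * g + B * f" "degree A < degree f" "degree B < degree g"
proof -
  obtain u v where uv: "u * f + v * g = 1"
    using bezout_coefficients_fst_snd[of f g] assms(1) by (metis coprime_iff_gcd_eq_1)
  \<comment> \<open>By Bezout v inverts g modulo f, so this A satisfies A g = P modulo f.\<close>
  define A where "A = P * v mod f"
  have "f \<noteq> 0" using assms(2) by auto
  from degree_mod_less[OF this, of "P * v"] have A: "degree A < degree f"
    unfolding A_def using assms(2) by auto
  have "P - A * g = P * (u * f + v * g) - A * g" by (simp add: uv)
  also have "\<dots> = f * (P * u) + (P * v - A) * g" by (simp add: algebra_simps)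
  also have "f dvd \<dots>" unfolding A_def by (simp add: dvd_minus_mod)
  finally obtain B where B: "P - A * g = f * B" by (rule dvdE)
  show ?thesis
  proof
    show "P = A * g + B * f" using B by (simp add: algebra_simps)
    show "degree A < degree f" by (rule A)
    show "degree B < degree g"
    proof (cases "B = 0")
      case False
      \<comment> \<open>Both P and A g have degree below deg f + deg g, hence so has f B, which
        bounds B.\<close>
      have "degree (A * g) < degree f + degree g"
        using A degree_mult_le[of A g] by simp
      then have "degree (f * B) < degree f + degree g"
        unfolding B[symmetric] using assms(4) by (intro degree_diff_less)
      then show ?thesis using False assms(2) by (subst (asm) degree_mult_eq) auto
    qed (use assms(3) in simp)
  qed
qed

text \<open>Otherwise the two are associated, hence equal up to a constant, and being monic forces
  that constant to be 1.\<close>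

lemma coprime_monic_irreducible:
  fixes f g :: "'k::field_gcd poly"
  assumes "irreducible f" "irreducible g" "lead_coeff f = 1" "lead_coeff g = 1" "f \<noteq> g"
  shows "coprime f g"
proof (rule ccontr)
  assume "\<not> coprime f g"
  then have "f dvd g"
    using assms(1) prime_elem_imp_coprime irreducible_imp_prime_elem by blast
  moreover have "\<not> is_unit f" using assms(1) by (rule irreducible_not_unit)
  ultimately obtain c where c: "g = f * c" "is_unit c"
    using assms(2) by (metis dvdE irreducibleD)
  then obtain a where "c = [:a:]" by (metis is_unit_polyE)
  then show False using c assms(3-5) by simp
qed

theorem theorem4p2:
  fixes T :: "'a pair_pre_digraph"
    and f g :: "int poly"
    and P :: "rat poly"
  assumes "undirected_tree T"
    and "main_factor_multiplicity T = 2"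
    and "main_poly T = of_int_poly (f * g)"
    and "f \<noteq> g"
    and "lead_coeff f = 1" and "lead_coeff g = 1"
    and "irreducible (of_int_poly f :: rat poly)"
    and "irreducible (of_int_poly g :: rat poly)"
    and "coronal T = Fract P (of_int_poly (f * g))"
    and "degree P < degree f + degree g"
    and "coprime P (of_int_poly (f * g))"
  shows "(\<exists>!AB. P = fst AB * of_int_poly g + snd AB * of_int_poly f \<and>
                degree (fst AB) < degree f \<and> degree (snd AB) < degree g) \<and>
         (\<forall>A B. P = A * of_int_poly g + B * of_int_poly f \<and>
                degree A < degree f \<and> degree B < degree g \<longrightarrow>
            (let \<Gamma>\<^sub>f = Fract A (of_int_poly f); \<Gamma>\<^sub>g = Fract B (of_int_poly g) in
              coronal T = \<Gamma>\<^sub>f + \<Gamma>\<^sub>g \<and>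
              coprime A (of_int_poly f) \<and> coprime B (of_int_poly g) \<and>
              (\<forall>(H :: 'b pair_pre_digraph) R U.
                 pair_graph H \<and> \<not> connected H \<and>
                 pre_digraph.sccs H = {with_proj R, with_proj U} \<and> R \<noteq> U \<and>
                 generalized_cospectral H T \<and>
                 main_poly R = of_int_poly f \<and> main_poly U = of_int_poly g \<longrightarrow>
                 coronal R = \<Gamma>\<^sub>f \<and> coronal U = \<Gamma>\<^sub>g)))"
proof -
  define F G :: "rat poly" where "F = of_int_poly f" and "G = of_int_poly g"
  have FG: "of_int_poly (f * g) = F * G"
    by (simp add: F_def G_def of_int_poly_hom.hom_mult)
  have deg: "degree F = degree f" "degree G = degree g" by (simp_all add: F_def G_def)
  have irr: "irreducible F" "irreducible G" using assms(7,8) by (simp_all add: F_def G_def)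
  have "lead_coeff F = 1" "lead_coeff G = 1" using assms(5,6) by (simp_all add: F_def G_def)
  moreover have "F \<noteq> G" using assms(4) by (simp add: F_def G_def)
  ultimately have cop: "coprime F G" using irr by (intro coprime_monic_irreducible)
  have pos: "degree F > 0" "degree G > 0"
    using irr by (auto simp: irreducible_def is_unit_iff_degree)
  then have nz: "F \<noteq> 0" "G \<noteq> 0" by auto
  have sum_Fract: "Fract A F + Fract B G = Fract (A * G + B * F) (F * G)" for A B
    using nz by simp
  have uniq: "A = A' \<and> B = B'"
    if "A * G + B * F = A' * G + B' * F" "degree A < degree f" "degree A' < degree f" for A B A' B'
    using partial_fractions_unique[OF cop that(1)] that(2,3) deg by simp
  have "\<exists>!AB. P = fst AB * G + snd AB * F \<and>
      degree (fst AB) < degree f \<and> degree (snd AB) < degree g"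
  proof -
    obtain A B where "P = A * G + B * F" "degree A < degree F" "degree B < degree G"
      using partial_fractions_exist[OF cop pos] assms(10) deg by metis
    then show ?thesis
      using uniq[of A B] deg by (intro ex1I[of _ "(A, B)"]) (simp, metis prod.collapse)
  qed
  moreover have "coronal T = Fract A F + Fract B G \<and> coprime A F \<and> coprime B G \<and>
      (\<forall>(H :: 'b pair_pre_digraph) R U.
         pair_graph H \<and> \<not> connected H \<and>
         pre_digraph.sccs H = {with_proj R, with_proj U} \<and> R \<noteq> U \<and>
         generalized_cospectral H T \<and>
         main_poly R = of_int_poly f \<and> main_poly U = of_int_poly g \<longrightarrow>
         coronal R = Fract A F \<and> coronal U = Fract B G)"
    if AB: "P = A * G + B * F" "degree A < degree f" "degree B < degree g" for A B
  proof (intro conjI allI impI; (elim conjE)?)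
    have cor_T: "coronal T = Fract P (F * G)" using assms(9) by (simp only: FG)
    then show "coronal T = Fract A F + Fract B G" by (simp only: sum_Fract AB(1))
    \<comment> \<open>A common divisor of A and F, or of B and G, divides both P = A G + B F and F
      G, so reducedness of P / (F G) passes to both parts.\<close>
    have unit: "is_unit c" if "c dvd P" "c dvd F * G" for c
      using assms(11) that unfolding FG by (rule coprime_common_divisor)
    show "coprime A F" by (rule coprimeI) (rule unit, auto simp: AB(1))
    show "coprime B G" by (rule coprimeI) (rule unit, auto simp: AB(1))
    fix H :: "'b pair_pre_digraph" and R U
    assume H: "pair_graph H" and sccs: "pre_digraph.sccs H = {with_proj R, with_proj U}"
      and "R \<noteq> U" and cosp: "generalized_cospectral H T"
      and main: "main_poly R = of_int_poly f" "main_poly U = of_int_poly g"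
    have mains: "main_poly R = map_poly of_rat F" "main_poly U = map_poly of_rat G"
      by (simp_all add: main F_def G_def map_poly_map_poly o_def)
    have R: "with_proj R \<in> pre_digraph.sccs H" and U: "with_proj U \<in> pre_digraph.sccs H"
      by (simp_all add: sccs)
    obtain A' where A': "coronal R = Fract A' F" "degree A' < degree F"
      using coronal_denominator[OF finite_sym_component[OF H R] mains(1) pos(1)] .
    obtain B' where B': "coronal U = Fract B' G" "degree B' < degree G"
      using coronal_denominator[OF finite_sym_component[OF H U] mains(2) pos(2)] .
    have "pair_graph T" using assms(1) by (simp add: undirected_tree_def)
    \<comment> \<open>Over the common denominator F G the component coronals give a second
      decomposition of P, which uniqueness identifies with A and B.\<close>
    from coronal_eq_of_generalized_cospectral[OF H this cosp]
    have "Fract P (F * G) = Fract (A' * G + B' * F) (F * G)"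
      using coronal_two_components[OF H sccs \<open>R \<noteq> U\<close>] by (simp only: cor_T A' B' sum_Fract)
    then have "P = A' * G + B' * F" using nz by (simp add: eq_fract)
    then have "A = A' \<and> B = B'" using AB A'(2) deg by (intro uniq) simp_all
    then show "coronal R = Fract A F" "coronal U = Fract B G" using A' B' by simp_all
  qed
  ultimately show ?thesis
    unfolding Let_def F_def[symmetric] G_def[symmetric] by blast
qed

end
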